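(* Let $\mathcal{C}$ be a subcategory of the category $\mathsf{Frm}$ of frames all of whose objects are IED. Then the Booleanization $L\mapsto B_L$ extends to a functor $B\colon\mathcal{C}\to\mathsf{CBAlg}$ such that, for each morphism $f\colon L\to M$ in $\mathcal{C}$, the inclusions $i_L\colon B_L\hookrightarrow L$ and $i_M\colon B_M\hookrightarrow M$ are frame homomorphisms, $B(f)\colon B_L\to B_M$ is a frame homomorphism, and $i_M\circ B(f)=f\circ i_L$.
   Context: A frame (= locale) is a complete lattice $L$ with $a\wedge\bigvee B=\bigvee\{a\wedge b\mid b\in B\}$ for all $a\in L$, $B\subseteq L$. A frame homomorphism preserves arbitrary joins (including $0$) and finite meets (including $1$); frames and frame homomorphisms form the category $\mathsf{Frm}$. $\mathsf{CBAlg}$ is the full subcategory of $\mathsf{Frm}$ whose objects are the complete Boolean algebras. The pseudocomplement of $a\in L$ is $a^*=a\to 0$, where $\to$ is the Heyting operation, and $a^{**}=(a^* )^*$. The Booleanization of $L$ is $B_L=\{a\in L\mid a^{**}=a\}=\{a^*\mid a\in L\}$ with the order induced from $L$; it is a complete Boolean algebra. $L$ is IED (infinitely extremally disconnected) if $(\bigvee a_i)^{**}\le\bigvee a_i^{**}$ for every family $\{a_i\}_{i\in I}\subseteq L$ (arbitrary index set). *)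

theory Defs
  imports "HOL-Algebra.Complete_Lattice"
begin

section \<open>Categories, subcategories and functors\<close>

record ('o, 'm) cat_data =
  Obj :: "'o set"
  Arr :: "'m set"
  Dom :: "'m \<Rightarrow> 'o"
  Cod :: "'m \<Rightarrow> 'o"
  Id :: "'o \<Rightarrow> 'm"
  Comp :: "'m \<Rightarrow> 'm \<Rightarrow> 'm"  \<comment> \<open>\<open>Comp C g f\<close> is \<open>g\<close> after \<open>f\<close>\<close>

definition Hom :: "('o, 'm) cat_data \<Rightarrow> 'o \<Rightarrow> 'o \<Rightarrow> 'm set" where
  "Hom C X Y = {f \<in> Arr C. Dom C f = X \<and> Cod C f = Y}"

locale category =
  fixes C :: "('o, 'm) cat_data"
  assumes Dom_closed: "f \<in> Arr C \<Longrightarrow> Dom C f \<in> Obj C"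
    and Cod_closed: "f \<in> Arr C \<Longrightarrow> Cod C f \<in> Obj C"
    and Id_closed: "X \<in> Obj C \<Longrightarrow> Id C X \<in> Hom C X X"
    and Comp_closed: "\<lbrakk>f \<in> Hom C X Y; g \<in> Hom C Y Z\<rbrakk> \<Longrightarrow> Comp C g f \<in> Hom C X Z"
    and Comp_Id_right: "f \<in> Hom C X Y \<Longrightarrow> Comp C f (Id C X) = f"
    and Comp_Id_left: "f \<in> Hom C X Y \<Longrightarrow> Comp C (Id C Y) f = f"
    and Comp_assoc: "\<lbrakk>f \<in> Hom C W X; g \<in> Hom C X Y; h \<in> Hom C Y Z\<rbrakk>
      \<Longrightarrow> Comp C (Comp C h g) f = Comp C h (Comp C g f)"

locale subcategory = C: category C + D: category D
  for C :: "('o, 'm) cat_data" and D :: "('o, 'm) cat_data" +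
  assumes Obj_subset: "Obj C \<subseteq> Obj D"
    and Arr_subset: "Arr C \<subseteq> Arr D"
    and Dom_eq: "f \<in> Arr C \<Longrightarrow> Dom C f = Dom D f"
    and Cod_eq: "f \<in> Arr C \<Longrightarrow> Cod C f = Cod D f"
    and Id_eq: "X \<in> Obj C \<Longrightarrow> Id C X = Id D X"
    and Comp_eq: "\<lbrakk>f \<in> Hom C X Y; g \<in> Hom C Y Z\<rbrakk> \<Longrightarrow> Comp C g f = Comp D g f"

definition full_subcat :: "('o, 'm) cat_data \<Rightarrow> ('o \<Rightarrow> bool) \<Rightarrow> ('o, 'm) cat_data" where
  "full_subcat D P =
     D\<lparr>Obj := {X \<in> Obj D. P X}, Arr := {f \<in> Arr D. P (Dom D f) \<and> P (Cod D f)}\<rparr>"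

lemma Hom_full_subcat:
  "Hom (full_subcat D P) X Y = {f \<in> Hom D X Y. P X \<and> P Y}"
  by (auto simp: Hom_def full_subcat_def)

lemma (in category) subcategory_full_subcat: "subcategory (full_subcat C P) C"
proof -
  have "category (full_subcat C P)"
  proof (unfold_locales, unfold Hom_full_subcat)
  qed (auto simp: full_subcat_def Dom_closed Cod_closed Id_closed Comp_Id_right Comp_Id_left
        intro: Comp_closed Comp_assoc)
  then interpret F: category "full_subcat C P" .
  show ?thesis
    by unfold_locales (auto simp: full_subcat_def)
qed

locale cat_functor = C: category C + D: category D
  for C :: "('o, 'm) cat_data" and D :: "('p, 'n) cat_data"
    and F_obj :: "'o \<Rightarrow> 'p" and F_arr :: "'m \<Rightarrow> 'n" +
  assumes F_obj_closed: "X \<in> Obj C \<Longrightarrow> F_obj X \<in> Obj D"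
    and F_arr_closed: "f \<in> Hom C X Y \<Longrightarrow> F_arr f \<in> Hom D (F_obj X) (F_obj Y)"
    and F_Id: "X \<in> Obj C \<Longrightarrow> F_arr (Id C X) = Id D (F_obj X)"
    and F_Comp: "\<lbrakk>f \<in> Hom C X Y; g \<in> Hom C Y Z\<rbrakk>
      \<Longrightarrow> F_arr (Comp C g f) = Comp D (F_arr g) (F_arr f)"


section \<open>The category of frames\<close>

locale frame = complete_lattice L for L :: "'a gorder" (structure) +
  assumes meet_sup_distrib:
    "\<lbrakk>a \<in> carrier L; B \<subseteq> carrier L\<rbrakk> \<Longrightarrow> a \<sqinter> \<Squnion>B = \<Squnion>((\<lambda>b. a \<sqinter> b) ` B)"

text \<open>The library predicate \<open>sup_pres\<close> covers the empty join, hence preservation of \<open>0\<close>.\<close>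

definition frame_hom :: "'a gorder \<Rightarrow> 'b gorder \<Rightarrow> ('a \<Rightarrow> 'b) \<Rightarrow> bool" where
  "frame_hom L M f \<longleftrightarrow>
     frame L \<and> frame M \<and> f \<in> carrier L \<rightarrow> carrier M \<and>
     sup_pres L M f \<and> meet_pres L M f \<and> f \<top>\<^bsub>L\<^esub> = \<top>\<^bsub>M\<^esub>"

text \<open>
  A morphism records its domain and codomain; its underlying function is made unique by
  requiring it to be \<open>undefined\<close> outside the carrier of the domain (see \<open>Frm\<close>).
\<close>

datatype 'a frm_arr = Frm_Arr (src: "'a gorder") (fn: "'a \<Rightarrow> 'a") (tgt: "'a gorder")

text \<open>
  The frames whose carrier is a subset of the arbitrary type \<open>'a\<close>, which plays the role of the
  universe. Orders that agree on the carrier but not off it count as distinct, isomorphic objects.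
\<close>

definition Frm :: "('a gorder, 'a frm_arr) cat_data" where
  "Frm = \<lparr>
     Obj = {L. frame L},
     Arr = {f. frame_hom (src f) (tgt f) (fn f) \<and> fn f \<in> extensional (carrier (src f))},
     Dom = src,
     Cod = tgt,
     Id = (\<lambda>L. Frm_Arr L (\<lambda>x\<in>carrier L. x) L),
     Comp = (\<lambda>g f. Frm_Arr (src f) (compose (carrier (src f)) (fn g) (fn f)) (tgt g))\<rparr>"

lemma frame_hom_cong:
  assumes "frame_hom L M f" and eq: "\<And>x. x \<in> carrier L \<Longrightarrow> g x = f x"
  shows "frame_hom L M g"
proof -
  interpret L: frame L using assms by (simp add: frame_hom_def)
  have "g ` A = f ` A" if "A \<subseteq> carrier L" for A
    using that eq by (auto intro!: image_cong)
  with assms show ?thesis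
    by (auto simp: frame_hom_def sup_pres_def meet_pres_def)
qed

lemma frame_hom_id: "frame L \<Longrightarrow> frame_hom L L (\<lambda>x. x)"
proof -
  assume "frame L"
  then interpret frame L .
  show ?thesis
    by (simp add: frame_hom_def sup_pres_def meet_pres_def frame_axioms complete_lattice_axioms
        lattice_axioms)
qed

lemma frame_hom_comp:
  assumes f: "frame_hom L M f" and g: "frame_hom M N g"
  shows "frame_hom L N (\<lambda>x. g (f x))"
proof -
  have fc: "f x \<in> carrier M" if "x \<in> carrier L" for x
    using f that by (auto simp: frame_hom_def)
  have "g (f (\<Squnion>\<^bsub>L\<^esub>A)) = \<Squnion>\<^bsub>N\<^esub>((\<lambda>x. g (f x)) ` A)" if "A \<subseteq> carrier L" for A
  proof -
    have "f ` A \<subseteq> carrier M" using that fc by auto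
    then show ?thesis
      using f g that by (simp add: frame_hom_def sup_pres_def image_image)
  qed
  with f g fc show ?thesis
    by (auto simp: frame_hom_def sup_pres_def meet_pres_def)
qed

lemma category_Frm: "category Frm"
proof
  fix X :: "'a gorder" assume "X \<in> Obj Frm"
  then show "Id Frm X \<in> Hom Frm X X"
    by (auto simp: Frm_def Hom_def intro: frame_hom_cong[OF frame_hom_id])
next
  fix f g :: "'a frm_arr" and X Y Z
  assume "f \<in> Hom Frm X Y" "g \<in> Hom Frm Y Z"
  then show "Comp Frm g f \<in> Hom Frm X Z"
    by (auto simp: Frm_def Hom_def compose_def intro: frame_hom_cong[OF frame_hom_comp])
next
  fix f :: "'a frm_arr" and X Y assume "f \<in> Hom Frm X Y"
  then show "Comp Frm f (Id Frm X) = f" "Comp Frm (Id Frm Y) f = f"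
    by (cases f; auto simp: Frm_def Hom_def compose_def frame_hom_def restrict_def
        extensional_def fun_eq_iff Pi_iff)+
next
  fix f g h :: "'a frm_arr" and W X Y Z
  assume "f \<in> Hom Frm W X" "g \<in> Hom Frm X Y" "h \<in> Hom Frm Y Z"
  then show "Comp Frm (Comp Frm h g) f = Comp Frm h (Comp Frm g f)"
    by (auto simp: Frm_def Hom_def compose_def frame_hom_def fun_eq_iff Pi_iff)
qed (auto simp: Frm_def frame_hom_def)


section \<open>Complete Boolean algebras\<close>

locale complete_boolean_alg = complete_lattice L for L :: "'a gorder" (structure) +
  assumes meet_join_distrib:
    "\<lbrakk>x \<in> carrier L; y \<in> carrier L; z \<in> carrier L\<rbrakk> \<Longrightarrow> x \<sqinter> (y \<squnion> z) = (x \<sqinter> y) \<squnion> (x \<sqinter> z)"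
    and complemented:
    "x \<in> carrier L \<Longrightarrow> \<exists>y\<in>carrier L. x \<sqinter> y = \<bottom> \<and> x \<squnion> y = \<top>"

definition CBAlg :: "('a gorder, 'a frm_arr) cat_data" where
  "CBAlg = full_subcat Frm complete_boolean_alg"


section \<open>Pseudocomplements, Booleanization and IED frames\<close>

definition heyting :: "'a gorder \<Rightarrow> 'a \<Rightarrow> 'a \<Rightarrow> 'a" where
  "heyting L a b = \<Squnion>\<^bsub>L\<^esub>{c \<in> carrier L. c \<sqinter>\<^bsub>L\<^esub> a \<sqsubseteq>\<^bsub>L\<^esub> b}"

lemma (in frame) heyting_closed: "heyting L a b \<in> carrier L"
  unfolding heyting_def by (rule sup_closed) auto

lemma (in frame) heyting_adjoint:
  assumes [simp]: "a \<in> carrier L" "b \<in> carrier L" "c \<in> carrier L"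
  shows "c \<sqsubseteq> heyting L a b \<longleftrightarrow> c \<sqinter> a \<sqsubseteq> b"
proof
  let ?S = "{c \<in> carrier L. c \<sqinter> a \<sqsubseteq> b}"
  have S: "?S \<subseteq> carrier L" by auto
  have h: "heyting L a b \<sqinter> a \<sqsubseteq> b"
  proof -
    have "heyting L a b \<sqinter> a = a \<sqinter> \<Squnion>?S"
      by (simp add: heyting_def meet_comm)
    also have "\<dots> = \<Squnion>((\<lambda>c. a \<sqinter> c) ` ?S)"
      by (rule meet_sup_distrib) auto
    also have "\<dots> \<sqsubseteq> b"
      by (rule sup_least) (auto simp: meet_comm)
    finally show ?thesis .
  qed
  assume "c \<sqsubseteq> heyting L a b"
  then have "c \<sqinter> a \<sqsubseteq> heyting L a b \<sqinter> a"
    by (meson assms heyting_closed meet_closed meet_le meet_left meet_right le_trans)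
  with h show "c \<sqinter> a \<sqsubseteq> b"
    by (meson assms heyting_closed meet_closed le_trans)
next
  assume "c \<sqinter> a \<sqsubseteq> b"
  then show "c \<sqsubseteq> heyting L a b"
    unfolding heyting_def by (intro sup_upper) auto
qed

definition pcompl :: "'a gorder \<Rightarrow> 'a \<Rightarrow> 'a" where
  "pcompl L a = heyting L a \<bottom>\<^bsub>L\<^esub>"

definition booleanization :: "'a gorder \<Rightarrow> 'a gorder" where
  "booleanization L = L\<lparr>carrier := {a \<in> carrier L. pcompl L (pcompl L a) = a}\<rparr>"

definition IED :: "'a gorder \<Rightarrow> bool" where
  "IED L \<longleftrightarrow> frame L \<and>
     (\<forall>A \<subseteq> carrier L.
        pcompl L (pcompl L (\<Squnion>\<^bsub>L\<^esub>A)) \<sqsubseteq>\<^bsub>L\<^esub> \<Squnion>\<^bsub>L\<^esub>((\<lambda>a. pcompl L (pcompl L a)) ` A))"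

text \<open>Quantifying over subsets is the same as quantifying over families with any index type.\<close>

lemma IED_family:
  assumes "IED L" "\<And>i. i \<in> I \<Longrightarrow> a i \<in> carrier L"
  shows "pcompl L (pcompl L (\<Squnion>\<^bsub>L\<^esub>(a ` I))) \<sqsubseteq>\<^bsub>L\<^esub> \<Squnion>\<^bsub>L\<^esub>((\<lambda>i. pcompl L (pcompl L (a i))) ` I)"
proof -
  have "a ` I \<subseteq> carrier L" using assms(2) by auto
  with assms(1) show ?thesis
    unfolding IED_def by (metis (no_types, lifting) image_cong image_image)
qed

definition bool_incl :: "'a gorder \<Rightarrow> 'a frm_arr" where
  "bool_incl L =
     Frm_Arr (booleanization L) (\<lambda>x\<in>carrier (booleanization L). x) L"

end

(*
  In an IED frame the regular elements are closed under arbitrary joins, so B_L is a subframe of L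
  and its joins and finite meets are those of L. For regular a the join of a and a* is therefore
  regular and dense, hence equal to 1: the regular elements are precisely the complemented ones.
  Frame homomorphisms preserve complements, so they restrict to the Booleanizations, and
  functoriality is that of restriction.
*)

theory Submission
  imports Defs
begin

section \<open>Pseudocomplements in a frame\<close>

context frame
begin

lemma sup_empty: "\<Squnion>{} = \<bottom>"
  using weak_sup_empty eq_is_equal by simp

lemma meet_join_distrib:
  assumes "x \<in> carrier L" "y \<in> carrier L" "z \<in> carrier L"
  shows "x \<sqinter> (y \<squnion> z) = (x \<sqinter> y) \<squnion> (x \<sqinter> z)"
  using meet_sup_distrib[of x "{y, z}"] assms by (simp add: join_def)

lemma pcompl_closed [simp]: "pcompl L a \<in> carrier L"
  by (simp add: pcompl_def heyting_closed)

text \<open>The Heyting adjunction at \<open>\<bottom>\<close>. The calculus of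
  \<open>pcompl\<close> below rests on this equivalence.\<close>

lemma le_pcompl_iff:
  assumes "a \<in> carrier L" "b \<in> carrier L"
  shows "b \<sqsubseteq> pcompl L a \<longleftrightarrow> b \<sqinter> a = \<bottom>"
proof -
  have "b \<sqsubseteq> pcompl L a \<longleftrightarrow> b \<sqinter> a \<sqsubseteq> \<bottom>"
    using assms by (simp add: pcompl_def heyting_adjoint)
  also have "\<dots> \<longleftrightarrow> b \<sqinter> a = \<bottom>"
    using assms by (auto intro: le_antisym)
  finally show ?thesis .
qed

lemma meet_pcompl: "a \<in> carrier L \<Longrightarrow> a \<sqinter> pcompl L a = \<bottom>"
  using le_pcompl_iff[of a "pcompl L a"] by (simp add: meet_comm)

lemma le_dneg: "a \<in> carrier L \<Longrightarrow> a \<sqsubseteq> pcompl L (pcompl L a)"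
  by (simp add: le_pcompl_iff meet_pcompl)

text \<open>From a \<le> b \<le> b** the elements a and b* are disjoint, which read the other way
  round is b* \<le> a*.\<close>

lemma pcompl_antimono:
  assumes "a \<in> carrier L" "b \<in> carrier L" "a \<sqsubseteq> b"
  shows "pcompl L b \<sqsubseteq> pcompl L a"
proof -
  have "a \<sqsubseteq> pcompl L (pcompl L b)"
    using le_trans[OF assms(3) le_dneg] assms by simp
  then show ?thesis
    using assms by (simp add: le_pcompl_iff meet_comm)
qed

lemma dneg_mono:
  assumes "a \<in> carrier L" "b \<in> carrier L" "a \<sqsubseteq> b"
  shows "pcompl L (pcompl L a) \<sqsubseteq> pcompl L (pcompl L b)"
  using assms by (intro pcompl_antimono) auto

text \<open>One inequality is \<open>le_dneg\<close> at a*; the other is antitonicity applied to a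
  \<le> a**.\<close>

lemma pcompl_triple:
  "a \<in> carrier L \<Longrightarrow> pcompl L (pcompl L (pcompl L a)) = pcompl L a"
  by (intro le_antisym le_dneg pcompl_antimono) auto

lemma pcompl_bottom: "pcompl L \<bottom> = \<top>"
  by (intro le_antisym) (auto simp: le_pcompl_iff intro!: le_antisym meet_right)

lemma pcompl_top: "pcompl L \<top> = \<bottom>"
  \<comment> \<open>\<open>le_iff_join\<close> describes the order through meets: it gives 1* = 1*
    \<and> 1, which is 0 by \<open>meet_pcompl\<close>.\<close>
  using meet_pcompl[of \<top>] le_iff_join[of "pcompl L \<top>" \<top>] by (simp add: meet_comm)

section \<open>Complemented, regular and dense elements\<close>

text \<open>Distributivity gives x* = x* \<and> (x \<or> y) = x* \<and> y \<le> y; disjointness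
  gives y \<le> x*.\<close>

lemma complement_eq_pcompl:
  assumes "x \<in> carrier L" "y \<in> carrier L" "x \<sqinter> y = \<bottom>" "x \<squnion> y = \<top>"
  shows "pcompl L x = y"
proof (rule le_antisym)
  have "pcompl L x = pcompl L x \<sqinter> \<top>"
    using le_iff_join[of "pcompl L x" \<top>] by simp
  also have "\<dots> = (pcompl L x \<sqinter> x) \<squnion> (pcompl L x \<sqinter> y)"
    using assms by (simp flip: assms(4) add: meet_join_distrib)
  also have "\<dots> \<sqsubseteq> y"
    using assms by (intro join_le) (auto simp: meet_pcompl meet_comm[of L _ x] intro: meet_right)
  finally show "pcompl L x \<sqsubseteq> y" .
  show "y \<sqsubseteq> pcompl L x"
    using assms by (simp add: le_pcompl_iff meet_comm)
qed (use assms in auto)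

text \<open>Being complements is a symmetric relation, so x* = y and y* = x. This works in every
  frame, in particular in the codomain of a frame homomorphism.\<close>

lemma complemented_imp_regular:
  assumes "x \<in> carrier L" "y \<in> carrier L" "x \<sqinter> y = \<bottom>" "x \<squnion> y = \<top>"
  shows "pcompl L (pcompl L x) = x"
proof -
  have "pcompl L x = y"
    using assms by (rule complement_eq_pcompl)
  moreover have "pcompl L y = x"
    using assms by (intro complement_eq_pcompl) (auto simp: meet_comm join_comm)
  ultimately show ?thesis by simp
qed

text \<open>The join of a and a* is dense: its pseudocomplement lies below both a* and a**, hence is
  0. An element that is regular and dense equals 0* = 1.\<close>

lemma regular_join_pcompl:
  assumes a: "a \<in> carrier L"
    and reg: "pcompl L (pcompl L (a \<squnion> pcompl L a)) = a \<squnion> pcompl L a"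
  shows "a \<squnion> pcompl L a = \<top>"
proof -
  let ?p = "pcompl L (a \<squnion> pcompl L a)"
  have "?p \<sqsubseteq> pcompl L a" "?p \<sqsubseteq> pcompl L (pcompl L a)"
    using a by (auto intro!: pcompl_antimono join_left join_right)
  then have "?p \<sqsubseteq> pcompl L a \<sqinter> pcompl L (pcompl L a)"
    by (intro meet_le) auto
  then have "?p = \<bottom>"
    by (intro le_antisym) (auto simp: meet_pcompl)
  with reg show ?thesis
    by (simp add: pcompl_bottom)
qed

end


section \<open>Subframes\<close>

text \<open>Closure under joins includes the empty join, so \<open>S\<close> also contains
  0.\<close>

locale subframe = frame L for L :: "'a gorder" (structure) +
  fixes S :: "'a set"
  assumes subset: "S \<subseteq> carrier L"
    and sup_mem: "A \<subseteq> S \<Longrightarrow> \<Squnion>A \<in> S"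
    and meet_mem: "\<lbrakk>x \<in> S; y \<in> S\<rbrakk> \<Longrightarrow> x \<sqinter> y \<in> S"
    and top_mem: "\<top> \<in> S"
begin

abbreviation sub :: "'a gorder" where
  "sub \<equiv> L\<lparr>carrier := S\<rparr>"

lemma memD: "x \<in> S \<Longrightarrow> x \<in> carrier L"
  using subset by auto

lemma partial_order_sub: "partial_order sub"
  by unfold_locales
    (use memD in \<open>auto simp: eq_is_equal intro: le_antisym le_trans\<close>)

lemma least_sub_sup:
  assumes "A \<subseteq> S"
  shows "least sub (\<Squnion>A) (Upper sub A)"
proof -
  have A: "A \<subseteq> carrier L" using assms subset by auto
  show ?thesis
    unfolding least_def Upper_def
    using assms A sup_mem[OF assms] memD by (auto intro!: sup_upper sup_least)
qed

lemma complete_lattice_sub: "complete_lattice sub"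
proof -
  interpret S: partial_order sub by (rule partial_order_sub)
  show ?thesis
  proof (rule S.complete_latticeI)
    fix A assume "A \<subseteq> carrier sub"
    then have A: "A \<subseteq> S" by simp
    show "\<exists>s. least sub s (Upper sub A)"
      using least_sub_sup[OF A] by blast
    \<comment> \<open>\<open>S\<close> may fail to be closed under infinite meets of
      \<open>L\<close>, so the infimum within \<open>S\<close> is the join of those lower bounds
      that lie in \<open>S\<close>.\<close>
    let ?D = "{x \<in> S. \<forall>a\<in>A. x \<sqsubseteq> a}"
    have "?D \<subseteq> S" by auto
    then have "greatest sub (\<Squnion>?D) (Lower sub A)"
      unfolding greatest_def Lower_def
      using A memD sup_mem[of ?D] by (auto intro!: sup_upper sup_least)
    then show "\<exists>i. greatest sub i (Lower sub A)" by blast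
  qed
qed

sublocale S: complete_lattice sub
  by (rule complete_lattice_sub)

lemma sup_sub: "A \<subseteq> S \<Longrightarrow> \<Squnion>\<^bsub>sub\<^esub>A = \<Squnion>A"
  using S.sup_lub[of A] least_sub_sup[of A] by (auto intro: S.least_unique)

lemma join_sub: "\<lbrakk>x \<in> S; y \<in> S\<rbrakk> \<Longrightarrow> x \<squnion>\<^bsub>sub\<^esub> y = x \<squnion> y"
  by (simp add: join_def sup_sub)

lemma join_mem: "\<lbrakk>x \<in> S; y \<in> S\<rbrakk> \<Longrightarrow> x \<squnion> y \<in> S"
  by (simp add: join_def sup_mem)

text \<open>The meet in \<open>L\<close> lies in \<open>S\<close> by \<open>meet_mem\<close>, so it
  is a lower bound in \<open>sub\<close>; conversely the meet in \<open>sub\<close> is a lower bound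
  in \<open>L\<close>, the order being the same.\<close>

lemma meet_sub:
  assumes "x \<in> S" "y \<in> S"
  shows "x \<sqinter>\<^bsub>sub\<^esub> y = x \<sqinter> y"
proof (rule le_antisym)
  have m: "x \<sqinter>\<^bsub>sub\<^esub> y \<in> S"
    using S.meet_closed[of x y] assms by simp
  show "x \<sqinter>\<^bsub>sub\<^esub> y \<sqsubseteq> x \<sqinter> y"
    using assms m S.meet_left[of x y] S.meet_right[of x y] by (intro meet_le) (auto simp: memD)
  show "x \<sqinter> y \<sqsubseteq> x \<sqinter>\<^bsub>sub\<^esub> y"
    using S.meet_le[of "x \<sqinter> y" x y] assms meet_mem by (simp add: memD meet_left meet_right)
  show "x \<sqinter>\<^bsub>sub\<^esub> y \<in> carrier L" using m by (rule memD)
  show "x \<sqinter> y \<in> carrier L" using assms by (simp add: memD)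
qed

lemma top_sub: "\<top>\<^bsub>sub\<^esub> = \<top>"
proof (rule le_antisym)
  have t: "\<top>\<^bsub>sub\<^esub> \<in> S" using S.top_closed by simp
  show "\<top> \<sqsubseteq> \<top>\<^bsub>sub\<^esub>" using S.top_higher[of \<top>] top_mem by simp
  show "\<top>\<^bsub>sub\<^esub> \<sqsubseteq> \<top>" "\<top>\<^bsub>sub\<^esub> \<in> carrier L" using t by (auto simp: memD)
qed simp

lemma bottom_sub: "\<bottom>\<^bsub>sub\<^esub> = \<bottom>"
  using S.weak_sup_empty sup_sub[of "{}"] by (simp add: eq_is_equal sup_empty)

lemma frame_sub: "frame sub"
proof
  fix a B assume "a \<in> carrier sub" "B \<subseteq> carrier sub"
  then have "a \<in> S" "B \<subseteq> S" by auto
  then have "(\<lambda>b. a \<sqinter>\<^bsub>sub\<^esub> b) ` B = (\<lambda>b. a \<sqinter> b) ` B"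
    by (intro image_cong) (auto simp: meet_sub)
  moreover have "(\<lambda>b. a \<sqinter> b) ` B \<subseteq> S"
    using \<open>a \<in> S\<close> \<open>B \<subseteq> S\<close> by (auto intro: meet_mem)
  ultimately show "a \<sqinter>\<^bsub>sub\<^esub> \<Squnion>\<^bsub>sub\<^esub>B = \<Squnion>\<^bsub>sub\<^esub>((\<lambda>b. a \<sqinter>\<^bsub>sub\<^esub> b) ` B)"
    using \<open>a \<in> S\<close> \<open>B \<subseteq> S\<close> subset by (simp add: sup_sub meet_sub sup_mem meet_sup_distrib memD)
qed

lemma frame_hom_inclusion: "frame_hom sub L (\<lambda>x. x)"
  using frame_sub frame_axioms memD
  by (auto simp: frame_hom_def sup_pres_def meet_pres_def complete_lattice_sub
      complete_lattice_axioms sup_sub meet_sub top_sub)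

text \<open>All values lie in \<open>S\<close>, where joins and binary meets agree with those of
  \<open>L\<close>, so preservation carries over.\<close>

lemma frame_hom_corestrict:
  assumes g: "frame_hom K L g" and im: "g \<in> carrier K \<rightarrow> S"
  shows "frame_hom K sub g"
proof -
  have "\<Squnion>\<^bsub>sub\<^esub>(g ` A) = \<Squnion>(g ` A)" if "A \<subseteq> carrier K" for A
    using that im by (intro sup_sub) auto
  moreover have "g x \<sqinter>\<^bsub>sub\<^esub> g y = g x \<sqinter> g y" if "x \<in> carrier K" "y \<in> carrier K" for x y
    using that im by (intro meet_sub) auto
  ultimately show ?thesis
    using g im frame_sub
    by (simp add: frame_hom_def sup_pres_def meet_pres_def complete_lattice_sub top_sub)
qed

end


section \<open>Booleanization\<close>

lemma carrier_booleanization: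
  "carrier (booleanization L) = {a \<in> carrier L. pcompl L (pcompl L a) = a}"
  by (simp add: booleanization_def)

text \<open>Presents the Booleanization in the shape of \<open>sub\<close>, so that facts about
  subframes apply. As a rewrite rule it is used from right to left; forwards it would loop.\<close>

lemma booleanization_eq: "booleanization L = L\<lparr>carrier := carrier (booleanization L)\<rparr>"
  by (simp add: booleanization_def)

text \<open>IED gives closure under joins. Binary meets stay regular because double pseudocomplement
  is monotone: (x \<and> y)** lies below x** = x and y** = y.\<close>

lemma IED_subframe:
  assumes "IED L"
  shows "subframe L (carrier (booleanization L))"
proof -
  interpret frame L using assms by (simp add: IED_def)
  show ?thesis
  proof (unfold_locales, unfold carrier_booleanization)
    show "\<top>\<^bsub>L\<^esub> \<in> {a \<in> carrier L. pcompl L (pcompl L a) = a}"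
      by (simp add: pcompl_top pcompl_bottom)
  next
    fix A assume A: "A \<subseteq> {a \<in> carrier L. pcompl L (pcompl L a) = a}"
    then have "A \<subseteq> carrier L" "(\<lambda>a. pcompl L (pcompl L a)) ` A = A" by force+
    \<comment> \<open>Double pseudocomplement fixes each element of \<open>A\<close>, so the
      right-hand side of the IED inequality is the join of \<open>A\<close> itself.\<close>
    moreover from this have "pcompl L (pcompl L (\<Squnion>\<^bsub>L\<^esub>A)) \<sqsubseteq>\<^bsub>L\<^esub> \<Squnion>\<^bsub>L\<^esub>A"
      using assms unfolding IED_def by metis
    ultimately show "\<Squnion>\<^bsub>L\<^esub>A \<in> {a \<in> carrier L. pcompl L (pcompl L a) = a}"
      by (auto intro!: le_antisym le_dneg)
  next
    fix x y
    assume "x \<in> {a \<in> carrier L. pcompl L (pcompl L a) = a}"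
      and "y \<in> {a \<in> carrier L. pcompl L (pcompl L a) = a}"
    then have c: "x \<in> carrier L" "y \<in> carrier L"
      and r: "pcompl L (pcompl L x) = x" "pcompl L (pcompl L y) = y" by auto
    have "pcompl L (pcompl L (x \<sqinter>\<^bsub>L\<^esub> y)) \<sqsubseteq>\<^bsub>L\<^esub> x"
      using dneg_mono[of "x \<sqinter>\<^bsub>L\<^esub> y" x] c r by (simp add: meet_left)
    moreover have "pcompl L (pcompl L (x \<sqinter>\<^bsub>L\<^esub> y)) \<sqsubseteq>\<^bsub>L\<^esub> y"
      using dneg_mono[of "x \<sqinter>\<^bsub>L\<^esub> y" y] c r by (simp add: meet_right)
    ultimately have "pcompl L (pcompl L (x \<sqinter>\<^bsub>L\<^esub> y)) \<sqsubseteq>\<^bsub>L\<^esub> x \<sqinter>\<^bsub>L\<^esub> y"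
      using c by (intro meet_le) auto
    then show "x \<sqinter>\<^bsub>L\<^esub> y \<in> {a \<in> carrier L. pcompl L (pcompl L a) = a}"
      using c by (auto intro!: le_antisym le_dneg)
  qed auto
qed

lemma IED_frame_booleanization: "IED L \<Longrightarrow> frame (booleanization L)"
  using subframe.frame_sub[OF IED_subframe] by (simp flip: booleanization_eq)

lemma IED_frame_hom_inclusion: "IED L \<Longrightarrow> frame_hom (booleanization L) L (\<lambda>x. x)"
  using subframe.frame_hom_inclusion[OF IED_subframe] by (simp flip: booleanization_eq)

text \<open>Since a* is regular by a*** = a*, closure under joins makes the join of a and a*
  regular, and \<open>regular_join_pcompl\<close> applies.\<close>

lemma IED_regular_complement:
  assumes "IED L" "a \<in> carrier (booleanization L)"
  shows "pcompl L a \<in> carrier (booleanization L)"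
    and "a \<sqinter>\<^bsub>L\<^esub> pcompl L a = \<bottom>\<^bsub>L\<^esub>"
    and "a \<squnion>\<^bsub>L\<^esub> pcompl L a = \<top>\<^bsub>L\<^esub>"
proof -
  interpret subframe L "carrier (booleanization L)" using assms(1) by (rule IED_subframe)
  have a: "a \<in> carrier L" using assms(2) by (rule memD)
  show p: "pcompl L a \<in> carrier (booleanization L)"
    using a by (simp add: carrier_booleanization pcompl_triple)
  show "a \<sqinter>\<^bsub>L\<^esub> pcompl L a = \<bottom>\<^bsub>L\<^esub>"
    using a by (rule meet_pcompl)
  show "a \<squnion>\<^bsub>L\<^esub> pcompl L a = \<top>\<^bsub>L\<^esub>"
    using a join_mem[OF assms(2) p] by (intro regular_join_pcompl) (auto simp: carrier_booleanization)
qed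

lemma IED_complete_boolean_alg:
  assumes "IED L"
  shows "complete_boolean_alg (booleanization L)"
proof -
  interpret subframe L "carrier (booleanization L)" using assms by (rule IED_subframe)
  interpret B: frame "booleanization L" using assms by (rule IED_frame_booleanization)
  show ?thesis
  proof
    fix x assume x: "x \<in> carrier (booleanization L)"
    note c = IED_regular_complement[OF assms x]
    have "x \<sqinter>\<^bsub>booleanization L\<^esub> pcompl L x = \<bottom>\<^bsub>booleanization L\<^esub>"
      "x \<squnion>\<^bsub>booleanization L\<^esub> pcompl L x = \<top>\<^bsub>booleanization L\<^esub>"
      \<comment> \<open>The complement found in \<open>L\<close> is one in the Booleanization,
        because finite meets and joins, 0 and 1 are those of \<open>L\<close>.\<close>
      using meet_sub[OF x c(1)] join_sub[OF x c(1)] bottom_sub top_sub c(2,3)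
      by (simp_all flip: booleanization_eq)
    with c(1) show "\<exists>y\<in>carrier (booleanization L).
        x \<sqinter>\<^bsub>booleanization L\<^esub> y = \<bottom>\<^bsub>booleanization L\<^esub> \<and>
        x \<squnion>\<^bsub>booleanization L\<^esub> y = \<top>\<^bsub>booleanization L\<^esub>"
      by blast
  \<comment> \<open>Finite distributivity is the frame law of the Booleanization for two-element
    joins.\<close>
  qed (rule B.meet_join_distrib)
qed

section \<open>Frame homomorphisms on regular elements\<close>

text \<open>Preservation of 0 and of binary joins comes from \<open>sup_pres\<close> at the empty
  set and at a pair.\<close>

lemma frame_hom_complemented:
  assumes f: "frame_hom L M f" and c: "x \<in> carrier L" "y \<in> carrier L"
    and xy: "x \<sqinter>\<^bsub>L\<^esub> y = \<bottom>\<^bsub>L\<^esub>" "x \<squnion>\<^bsub>L\<^esub> y = \<top>\<^bsub>L\<^esub>"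
  shows "f x \<sqinter>\<^bsub>M\<^esub> f y = \<bottom>\<^bsub>M\<^esub>" "f x \<squnion>\<^bsub>M\<^esub> f y = \<top>\<^bsub>M\<^esub>"
proof -
  interpret L: frame L using f by (simp add: frame_hom_def)
  interpret M: frame M using f by (simp add: frame_hom_def)
  have sup: "f (\<Squnion>\<^bsub>L\<^esub>A) = \<Squnion>\<^bsub>M\<^esub>(f ` A)" if "A \<subseteq> carrier L" for A
    using f that by (simp add: frame_hom_def sup_pres_def)
  have "f \<bottom>\<^bsub>L\<^esub> = \<bottom>\<^bsub>M\<^esub>"
    using sup[of "{}"] by (simp add: L.sup_empty M.sup_empty)
  moreover have "f (x \<sqinter>\<^bsub>L\<^esub> y) = f x \<sqinter>\<^bsub>M\<^esub> f y"
    using f c by (simp add: frame_hom_def meet_pres_def)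
  ultimately show "f x \<sqinter>\<^bsub>M\<^esub> f y = \<bottom>\<^bsub>M\<^esub>"
    using xy(1) by simp
  have "f (x \<squnion>\<^bsub>L\<^esub> y) = f x \<squnion>\<^bsub>M\<^esub> f y"
    using sup[of "{x, y}"] c by (simp add: join_def)
  then show "f x \<squnion>\<^bsub>M\<^esub> f y = \<top>\<^bsub>M\<^esub>"
    using xy(2) f by (simp add: frame_hom_def)
qed

text \<open>IED of the domain makes the regular element x complemented by x*. The images of x and x*
  are complements in \<open>M\<close>, and complemented elements are regular in any frame.\<close>

lemma frame_hom_regular:
  assumes "IED L" and f: "frame_hom L M f" and x: "x \<in> carrier (booleanization L)"
  shows "f x \<in> carrier (booleanization M)"
proof -
  interpret L: frame L using f by (simp add: frame_hom_def)
  interpret M: frame M using f by (simp add: frame_hom_def)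
  have c: "x \<in> carrier L" using x by (simp add: carrier_booleanization)
  have fc: "f x \<in> carrier M" "f (pcompl L x) \<in> carrier M"
    using f c by (auto simp: frame_hom_def)
  note h = frame_hom_complemented[OF f c L.pcompl_closed IED_regular_complement(2,3)[OF assms(1) x]]
  show ?thesis
    using M.complemented_imp_regular[OF fc h] fc by (simp add: carrier_booleanization)
qed

text \<open>The inclusion of B_L followed by f takes regular values, so it corestricts to the
  subframe B_M.\<close>

lemma frame_hom_booleanization:
  assumes "IED L" "IED M" and f: "frame_hom L M f"
  shows "frame_hom (booleanization L) (booleanization M) f"
  using subframe.frame_hom_corestrict[OF IED_subframe[OF assms(2)]
      frame_hom_comp[OF IED_frame_hom_inclusion[OF assms(1)] f]]
    frame_hom_regular[OF assms(1) f]
  by (auto simp flip: booleanization_eq)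

section \<open>The functor on morphisms and its compatibility with the inclusions\<close>

text \<open>The function is cut down to the regular elements because arrows of \<open>Frm\<close>
  must be \<open>undefined\<close> off the carrier of their domain.\<close>

definition booleanization_arr :: "'a frm_arr \<Rightarrow> 'a frm_arr" where
  "booleanization_arr f = Frm_Arr (booleanization (src f))
     (restrict (fn f) (carrier (booleanization (src f)))) (booleanization (tgt f))"

lemma Hom_Frm:
  "f \<in> Hom Frm L M \<longleftrightarrow>
     src f = L \<and> tgt f = M \<and> frame_hom L M (fn f) \<and> fn f \<in> extensional (carrier L)"
  by (auto simp: Hom_def Frm_def)

lemma Comp_Frm:
  "Comp Frm g f = Frm_Arr (src f) (compose (carrier (src f)) (fn g) (fn f)) (tgt g)"
  by (simp add: Frm_def)

lemma bool_incl_Hom: "IED L \<Longrightarrow> bool_incl L \<in> Hom Frm (booleanization L) L"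
  by (auto simp: Hom_Frm bool_incl_def intro: frame_hom_cong[OF IED_frame_hom_inclusion])

lemma booleanization_arr_Hom:
  assumes "IED L" "IED M" "f \<in> Hom Frm L M"
  shows "booleanization_arr f \<in> Hom Frm (booleanization L) (booleanization M)"
  using assms
  by (auto simp: Hom_Frm booleanization_arr_def intro!: frame_hom_cong[OF frame_hom_booleanization])

lemma booleanization_arr_Id:
  "booleanization_arr (Id Frm L) = Id Frm (booleanization L)"
  by (auto simp: booleanization_arr_def Frm_def carrier_booleanization restrict_def)

text \<open>For regular x the value f x is again regular, so the restricted g is evaluated where it
  agrees with g and not at its default \<open>undefined\<close>.\<close>

lemma booleanization_arr_Comp:
  assumes "IED L" "f \<in> Hom Frm L M" "g \<in> Hom Frm M N"
  shows "booleanization_arr (Comp Frm g f) =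
    Comp Frm (booleanization_arr g) (booleanization_arr f)"
proof -
  have "fn f x \<in> carrier (booleanization M)" if "x \<in> carrier (booleanization L)" for x
    using assms that by (auto simp: Hom_Frm intro: frame_hom_regular)
  moreover have "carrier (booleanization L) \<subseteq> carrier L"
    by (auto simp: carrier_booleanization)
  ultimately show ?thesis
    using assms(2,3) by (auto simp: Hom_Frm booleanization_arr_def Comp_Frm compose_def fun_eq_iff)
qed

text \<open>Both sides send a regular x to f x; on the left, regularity of f x keeps the inclusion
  of B_M away from its default value.\<close>

lemma bool_incl_natural:
  assumes "IED L" "f \<in> Hom Frm L M"
  shows "Comp Frm (bool_incl M) (booleanization_arr f) = Comp Frm f (bool_incl L)"
  using assms frame_hom_regular[of L M "fn f"]
  by (auto simp: Hom_Frm booleanization_arr_def bool_incl_def Comp_Frm compose_def fun_eq_iff)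

lemma Hom_CBAlg:
  "f \<in> Hom CBAlg L M \<longleftrightarrow>
     f \<in> Hom Frm L M \<and> complete_boolean_alg L \<and> complete_boolean_alg M"
  by (simp add: CBAlg_def Hom_full_subcat)

theorem lemma7p1:
  fixes C :: "('a gorder, 'a frm_arr) cat_data"
  assumes "subcategory C Frm"
    and "\<And>L. L \<in> Obj C \<Longrightarrow> IED L"
  shows "\<exists>B :: 'a frm_arr \<Rightarrow> 'a frm_arr.
    cat_functor C CBAlg booleanization B \<and>
    (\<forall>L\<in>Obj C. \<forall>M\<in>Obj C. \<forall>f\<in>Hom C L M.
       bool_incl L \<in> Hom Frm (booleanization L) L \<and>
       bool_incl M \<in> Hom Frm (booleanization M) M \<and>
       B f \<in> Hom Frm (booleanization L) (booleanization M) \<and>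
       Comp Frm (bool_incl M) (B f) = Comp Frm f (bool_incl L))"
proof -
  interpret C: subcategory C Frm by (rule assms(1))
  interpret CBAlg: category "CBAlg :: ('a gorder, 'a frm_arr) cat_data"
    unfolding CBAlg_def
    using category.subcategory_full_subcat[OF category_Frm] by (rule subcategory.axioms(1))
  \<comment> \<open>Arrows of \<open>C\<close> keep their endpoints in \<open>Frm\<close>, and these
    endpoints are objects of \<open>C\<close>, hence IED.\<close>
  have homD: "f \<in> Hom Frm L M" "IED L" "IED M" if "f \<in> Hom C L M" for f L M
    using that C.Arr_subset C.Dom_eq C.Cod_eq C.C.Dom_closed C.C.Cod_closed assms(2)
    by (auto simp: Hom_def)
  have "cat_functor C CBAlg booleanization booleanization_arr"
  proof
    fix L assume L: "L \<in> Obj C"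
    show "booleanization L \<in> Obj CBAlg"
      using assms(2)[OF L]
      by (simp add: CBAlg_def full_subcat_def Frm_def IED_frame_booleanization
          IED_complete_boolean_alg)
    show "booleanization_arr (Id C L) = Id CBAlg (booleanization L)"
      using L by (simp add: C.Id_eq booleanization_arr_Id CBAlg_def full_subcat_def)
  next
    fix f L M assume "f \<in> Hom C L M"
    then show "booleanization_arr f \<in> Hom CBAlg (booleanization L) (booleanization M)"
      by (simp add: homD Hom_CBAlg booleanization_arr_Hom IED_complete_boolean_alg)
  next
    fix f g L M N assume fg: "f \<in> Hom C L M" "g \<in> Hom C M N"
    show "booleanization_arr (Comp C g f) =
        Comp CBAlg (booleanization_arr g) (booleanization_arr f)"
      \<comment> \<open>Composition in \<open>C\<close> and in \<open>CBAlg\<close> is that of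
        \<open>Frm\<close>: the former by \<open>Comp_eq\<close>, the latter because
        \<open>full_subcat\<close> changes only objects and arrows.\<close>
      using booleanization_arr_Comp[OF homD(2,1)[OF fg(1)] homD(1)[OF fg(2)]]
      by (simp add: C.Comp_eq[OF fg] CBAlg_def full_subcat_def)
  qed
  then show ?thesis
    using homD by (blast intro: bool_incl_Hom booleanization_arr_Hom bool_incl_natural)
qed

end
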